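(* Let $m\ge 1$ and $k$ be integers and let $B=\begin{pmatrix} m & 0\\ 0 & m\end{pmatrix}$. Then the space $J^1_{k,m}(\Gamma^1(\mathcal{O}))$ is isomorphic to the space $J_{k,B}(\Gamma^2)$ as a vector space over $\mathbb{C}$.
   Context: Notation: $\mathcal{O}=\mathbb{Z}[i]$, $\mathcal{O}^{\#}=\frac{i}{2}\mathcal{O}$ (the inverse different), $N(r)=r\overline{r}$, $e(z)=e^{2\pi i z}$, $\mathcal{H}$ is the complex upper half-plane. The space $J^1_{k,m}(\Gamma^1(\mathcal{O}))$, where $\Gamma^1(\mathcal{O})=SL_2(\mathbb{Z})\ltimes\mathcal{O}^2$, consists of the holomorphic functions $\phi:\mathcal{H}\times\mathbb{C}^2\to\mathbb{C}$ such that: (1) for all $\begin{pmatrix} a&b\\c&d\end{pmatrix}\in SL_2(\mathbb{Z})$, $(c\tau+d)^{-k}e^{-2\pi i m c z_1z_2/(c\tau+d)}\,\phi\left(\frac{a\tau+b}{c\tau+d},\frac{z_1}{c\tau+d},\frac{z_2}{c\tau+d}\right)=\phi(\tau,z_1,z_2)$; (2) for all $\lambda,\mu\in\mathcal{O}$, $e^{2\pi i m(\lambda\overline{\lambda}\tau+\overline{\lambda}z_1+\lambda z_2)}\,\phi(\tau,z_1+\lambda\tau+\mu,z_2+\overline{\lambda}\tau+\overline{\mu})=\phi(\tau,z_1,z_2)$; (3) $\phi$ has a Fourier expansion $\phi(\tau,z_1,z_2)=\sum_{n\in\mathbb{Z},\,r\in\mathcal{O}^{\#},\,N(r)\le mn}c(\phi;n,r)\,e(n\tau+rz_1+\overline{r}z_2)$.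 Let $M$ be a symmetric, positive definite, half-integral $l\times l$ matrix with integral diagonal entries, $M^{\#}$ its adjugate, and write $U[V]=V^tUV$. The space $J_{k,M}(\Gamma^l)$, where $\Gamma^l=SL_2(\mathbb{Z})\ltimes(\mathbb{Z}^l\times\mathbb{Z}^l)$, consists of the holomorphic functions $\phi:\mathcal{H}\times\mathbb{C}^l\to\mathbb{C}$ such that: (1') for all $\begin{pmatrix} a&b\\c&d\end{pmatrix}\in SL_2(\mathbb{Z})$ and $z\in\mathbb{C}^l$, $(c\tau+d)^{-k}e^{-2\pi i cM[z]/(c\tau+d)}\,\phi\left(\frac{a\tau+b}{c\tau+d},\frac{z}{c\tau+d}\right)=\phi(\tau,z)$; (2') for all $\lambda,\mu\in\mathbb{Z}^l$, $e^{2\pi i(\tau M[\lambda]+2\lambda^tMz)}\,\phi(\tau,z+\lambda\tau+\mu)=\phi(\tau,z)$; (3') $\phi$ has a Fourier expansion $\phi(\tau,z)=\sum_{0\le n\in\mathbb{Z},\,r\in\mathbb{Z}^l,\,4\det(M)n-M^{\#}[r]\ge 0}c(\phi;n,r)\,e(n\tau+r^tz)$. *)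

theory Defs
  imports "HOL-Analysis.Analysis" "HOL-Library.Function_Algebras"
begin

definition upper_half_plane :: "complex set" where
  "upper_half_plane = {\<tau>. Im \<tau> > 0}"

definition e2pi :: "complex \<Rightarrow> complex" where
  "e2pi z = exp (2 * of_real pi * \<i> * z)"

definition gaussian_integers :: "complex set" where
  "gaussian_integers = {of_int a + of_int b * \<i> | a b. True}"

definition inverse_different :: "complex set" where
  "inverse_different = {\<i> / 2 * x | x. x \<in> gaussian_integers}"

definition gnorm :: "complex \<Rightarrow> real" where
  "gnorm r = Re (r * cnj r)"

definition of_int_vec :: "int ^ 'l \<Rightarrow> 'a::ring_1 ^ 'l" where
  "of_int_vec v = (\<chi> i. of_int (v $ i))"

text \<open>
  \<open>M[v] = v\<^sup>t M v\<close>.  For complex vectors this has to be the bilinear \<^const>\<open>scalar_product\<close>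
  and not the (real-valued) inner product of the type class \<^class>\<open>real_inner\<close>.
\<close>

definition quad_form :: "'a::comm_ring_1 ^ 'l ^ 'l \<Rightarrow> 'a ^ 'l \<Rightarrow> 'a" where
  "quad_form M v = scalar_product v (M *v v)"

text \<open>
  The \<open>(i, j)\<close> entry of the adjugate is the \<open>(j, i)\<close> cofactor of \<open>M\<close>, that is, the determinant
  of \<open>M\<close> with row \<open>j\<close> replaced by the \<open>i\<close>-th unit vector.
\<close>

definition adjugate :: "'a::comm_ring_1 ^ 'l ^ 'l \<Rightarrow> 'a ^ 'l ^ 'l" where
  "adjugate M = (\<chi> i j. det (\<chi> p. if p = j then axis i 1 else M $ p))"

lemma matrix_mult_adjugate:
  fixes M :: "'a::comm_ring_1 ^ 'l ^ 'l"
  shows "M ** adjugate M = mat (det M)"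
proof -
  have "(M ** adjugate M) $ i $ j = mat (det M) $ i $ j" for i j
  proof -
    have row: "(\<Sum>k\<in>UNIV. M $ i $ k *s axis k 1) = M $ i"
      by (simp add: basis_expansion)
    have "(M ** adjugate M) $ i $ j
        = (\<Sum>k\<in>UNIV. det (\<chi> p. if p = j then M $ i $ k *s axis k 1 else M $ p))"
      by (simp add: matrix_matrix_mult_def adjugate_def det_row_mul)
    also have "\<dots> = det (\<chi> p. if p = j then M $ i else M $ p)"
      using det_linear_row_sum[OF finite, of j "\<lambda>_ k. M $ i $ k *s axis k 1" "UNIV" "\<lambda>p. M $ p"]
      unfolding row by (rule sym)
    also have "\<dots> = mat (det M) $ i $ j"
    proof (cases "i = j")
      case True
      then have "(\<chi> p. if p = j then M $ i else M $ p) = M"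
        by (simp add: vec_eq_iff)
      then show ?thesis using True by (simp add: mat_def)
    next
      case False
      then have "det (\<chi> p. if p = j then M $ i else M $ p) = 0"
        by (intro det_identical_rows[of i j]) (auto simp: row_def vec_eq_iff)
      then show ?thesis using False by (simp add: mat_def)
    qed
    finally show ?thesis .
  qed
  then show ?thesis by (simp add: vec_eq_iff)
qed

text \<open>
  Holomorphy in several variables is complex differentiability: the Frechet derivative exists and
  is complex linear.  A function with domain \<open>\<H> \<times> \<complex>\<^sup>l\<close> is represented by the total function
  that extends it by \<open>0\<close>, so that equality and the vector space operations of the function type are
  those of functions on \<open>\<H> \<times> \<complex>\<^sup>l\<close>.
\<close>

definition holomorphic_functions :: "(complex \<times> (complex ^ 'l) \<Rightarrow> complex) set" where
  "holomorphic_functions = {\<phi>.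
     (\<forall>p \<in> upper_half_plane \<times> UNIV.
        \<exists>D. (\<phi> has_derivative D) (at p) \<and> (\<forall>c h v. D (c * h, c *s v) = c * D (h, v))) \<and>
     (\<forall>p. p \<notin> upper_half_plane \<times> UNIV \<longrightarrow> \<phi> p = 0)}"

text \<open>
  A point \<open>(\<tau>, z\<^sub>1, z\<^sub>2)\<close> is represented as \<open>(\<tau>, vector [z\<^sub>1, z\<^sub>2])\<close>.  A Fourier expansion is a
  family of coefficients, the same for all points, whose series converges unconditionally (hence
  absolutely) to the function at every point.
\<close>

definition hermitian_jacobi_forms :: "int \<Rightarrow> int \<Rightarrow> (complex \<times> (complex ^ 2) \<Rightarrow> complex) set" where
  "hermitian_jacobi_forms k m = {\<phi> \<in> holomorphic_functions.
     (\<forall>a b c d :: int. a * d - b * c = 1 \<longrightarrow>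
       (\<forall>\<tau> \<in> upper_half_plane. \<forall>z1 z2.
         (of_int c * \<tau> + of_int d) powi (- k) *
         e2pi (- (of_int m * of_int c * z1 * z2 / (of_int c * \<tau> + of_int d))) *
         \<phi> ((of_int a * \<tau> + of_int b) / (of_int c * \<tau> + of_int d),
            vector [z1 / (of_int c * \<tau> + of_int d), z2 / (of_int c * \<tau> + of_int d)])
         = \<phi> (\<tau>, vector [z1, z2]))) \<and>
     (\<forall>lam \<in> gaussian_integers. \<forall>mu \<in> gaussian_integers. \<forall>\<tau> \<in> upper_half_plane. \<forall>z1 z2.
         e2pi (of_int m * (lam * cnj lam * \<tau> + cnj lam * z1 + lam * z2)) *
         \<phi> (\<tau>, vector [z1 + lam * \<tau> + mu, z2 + cnj lam * \<tau> + cnj mu])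
         = \<phi> (\<tau>, vector [z1, z2])) \<and>
     (\<exists>C :: int \<Rightarrow> complex \<Rightarrow> complex. \<forall>\<tau> \<in> upper_half_plane. \<forall>z1 z2.
         ((\<lambda>(n, r). C n r * e2pi (of_int n * \<tau> + r * z1 + cnj r * z2))
            has_sum \<phi> (\<tau>, vector [z1, z2]))
         {(n, r). r \<in> inverse_different \<and> gnorm r \<le> of_int m * of_int n})}"

text \<open>A matrix is half-integral if its double is integral.\<close>

definition jacobi_index :: "real ^ 'l ^ 'l \<Rightarrow> bool" where
  "jacobi_index M \<longleftrightarrow>
     transpose M = M \<and> (\<forall>v. v \<noteq> 0 \<longrightarrow> quad_form M v > 0) \<and>
     (\<forall>i j. 2 * M $ i $ j \<in> \<int>) \<and> (\<forall>i. M $ i $ i \<in> \<int>)"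

definition jacobi_forms ::
  "int \<Rightarrow> real ^ 'l ^ 'l \<Rightarrow> (complex \<times> (complex ^ 'l) \<Rightarrow> complex) set" where
  "jacobi_forms k M = {\<phi> \<in> holomorphic_functions.
     (\<forall>a b c d :: int. a * d - b * c = 1 \<longrightarrow>
       (\<forall>\<tau> \<in> upper_half_plane. \<forall>z.
         (of_int c * \<tau> + of_int d) powi (- k) *
         e2pi (- (of_int c * quad_form (map_matrix of_real M) z / (of_int c * \<tau> + of_int d))) *
         \<phi> ((of_int a * \<tau> + of_int b) / (of_int c * \<tau> + of_int d),
            (1 / (of_int c * \<tau> + of_int d)) *s z)
         = \<phi> (\<tau>, z))) \<and>
     (\<forall>lam mu :: int ^ 'l. \<forall>\<tau> \<in> upper_half_plane. \<forall>z.
         e2pi (\<tau> * quad_form (map_matrix of_real M) (of_int_vec lam)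
               + 2 * scalar_product (of_int_vec lam) (map_matrix of_real M *v z)) *
         \<phi> (\<tau>, z + \<tau> *s of_int_vec lam + of_int_vec mu)
         = \<phi> (\<tau>, z)) \<and>
     (\<exists>C :: int \<Rightarrow> int ^ 'l \<Rightarrow> complex. \<forall>\<tau> \<in> upper_half_plane. \<forall>z.
         ((\<lambda>(n, r). C n r * e2pi (of_int n * \<tau> + scalar_product (of_int_vec r) z))
            has_sum \<phi> (\<tau>, z))
         {(n, r). 0 \<le> n \<and> 4 * det M * of_int n - quad_form (adjugate M) (of_int_vec r) \<ge> 0})}"

lemma jacobi_index_scalar:
  fixes m :: int
  assumes "m \<ge> 1"
  shows "jacobi_index (vector [vector [of_int m, 0], vector [0, of_int m]] :: real ^ 2 ^ 2)"
proof -
  have "0 < v $ 1 * (real_of_int m * v $ 1) + v $ 2 * (real_of_int m * v $ 2)"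
    if "v \<noteq> 0" for v :: "real ^ 2"
  proof -
    have "v $ 1 \<noteq> 0 \<or> v $ 2 \<noteq> 0"
      using that by (auto simp: vec_eq_iff forall_2)
    then have "0 < (v $ 1)\<^sup>2 + (v $ 2)\<^sup>2"
      by (simp add: sum_power2_gt_zero_iff)
    then have "0 < real_of_int m * ((v $ 1)\<^sup>2 + (v $ 2)\<^sup>2)"
      using assms by simp
    then show ?thesis by (simp add: power2_eq_square algebra_simps)
  qed
  then show ?thesis
    by (auto simp: jacobi_index_def quad_form_def scalar_product_def matrix_vector_mult_def
        transpose_def vec_eq_iff forall_2 sum_2)
qed

definition cscale :: "complex \<Rightarrow> ('a \<Rightarrow> complex) \<Rightarrow> 'a \<Rightarrow> complex" where
  "cscale c f = (\<lambda>x. c * f x)"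

interpretation cfun: vector_space cscale
  by unfold_locales (auto simp: cscale_def fun_eq_iff algebra_simps)

definition isomorphic_function_spaces ::
  "('a \<Rightarrow> complex) set \<Rightarrow> ('b \<Rightarrow> complex) set \<Rightarrow> bool" where
  "isomorphic_function_spaces V W \<longleftrightarrow>
     (\<exists>T. bij_betw T V W \<and>
        (\<forall>f\<in>V. \<forall>g\<in>V. T (f + g) = T f + T g) \<and>
        (\<forall>c. \<forall>f\<in>V. T (cscale c f) = cscale c (T f)))"

lemma subspace_holomorphic_functions: "cfun.subspace holomorphic_functions"
proof (rule cfun.subspaceI)
  show "0 \<in> holomorphic_functions"
    by (auto simp: holomorphic_functions_def zero_fun_def intro!: exI[of _ "\<lambda>_. 0"])
next
  fix f g :: "complex \<times> (complex ^ 'l) \<Rightarrow> complex"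
  assume f: "f \<in> holomorphic_functions" and g: "g \<in> holomorphic_functions"
  have "\<exists>D. (f + g has_derivative D) (at p) \<and> (\<forall>c h v. D (c * h, c *s v) = c * D (h, v))"
    if p: "p \<in> upper_half_plane \<times> UNIV" for p
  proof -
    obtain D E where "(f has_derivative D) (at p)" "\<forall>c h v. D (c * h, c *s v) = c * D (h, v)"
      "(g has_derivative E) (at p)" "\<forall>c h v. E (c * h, c *s v) = c * E (h, v)"
      using f g p unfolding holomorphic_functions_def by blast
    then show ?thesis
      by (intro exI[of _ "\<lambda>x. D x + E x"])
        (auto simp: plus_fun_def algebra_simps intro!: has_derivative_add)
  qed
  then show "f + g \<in> holomorphic_functions"
    using f g by (auto simp: holomorphic_functions_def)
next
  fix c :: complex and f :: "complex \<times> (complex ^ 'l) \<Rightarrow> complex"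
  assume f: "f \<in> holomorphic_functions"
  have "\<exists>D. (cscale c f has_derivative D) (at p) \<and> (\<forall>c h v. D (c * h, c *s v) = c * D (h, v))"
    if p: "p \<in> upper_half_plane \<times> UNIV" for p
  proof -
    obtain D where "(f has_derivative D) (at p)" "\<forall>c h v. D (c * h, c *s v) = c * D (h, v)"
      using f p unfolding holomorphic_functions_def by blast
    then show ?thesis
      by (intro exI[of _ "\<lambda>x. c * D x"])
        (auto simp: cscale_def algebra_simps intro!: has_derivative_mult_right)
  qed
  then show "cscale c f \<in> holomorphic_functions"
    using f by (auto simp: holomorphic_functions_def cscale_def)
qed

lemma has_sum_fourier_add:
  assumes "((\<lambda>(n, r). C n r * E n r) has_sum s) A" "((\<lambda>(n, r). D n r * E n r) has_sum t) A"
  shows "((\<lambda>(n, r). (C n r + D n r) * (E n r :: complex)) has_sum (s + t)) A"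
  using has_sum_add[OF assms] by (simp add: case_prod_unfold distrib_right)

lemma has_sum_fourier_scale:
  assumes "((\<lambda>(n, r). C n r * E n r) has_sum s) A"
  shows "((\<lambda>(n, r). (c * C n r) * (E n r :: complex)) has_sum (c * s)) A"
  using has_sum_cmult_right[OF assms, of c] by (simp add: case_prod_unfold mult.assoc)

lemma subspace_hermitian_jacobi_forms: "cfun.subspace (hermitian_jacobi_forms k m)"
proof (rule cfun.subspaceI)
  show "0 \<in> hermitian_jacobi_forms k m"
    using cfun.subspace_0[OF subspace_holomorphic_functions]
    by (auto simp: hermitian_jacobi_forms_def case_prod_unfold intro!: exI[of _ "\<lambda>_ _. 0"])
next
  fix f g assume f: "f \<in> hermitian_jacobi_forms k m" and g: "g \<in> hermitian_jacobi_forms k m"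
  have "f + g \<in> holomorphic_functions"
    using f g cfun.subspace_add[OF subspace_holomorphic_functions]
    by (auto simp: hermitian_jacobi_forms_def)
  then show "f + g \<in> hermitian_jacobi_forms k m"
    using f g unfolding hermitian_jacobi_forms_def mem_Collect_eq
    apply (elim conjE exE)
    subgoal for C D
      by (intro conjI exI[of _ "\<lambda>n r. C n r + D n r"])
        (simp_all add: distrib_left has_sum_fourier_add)
    done
next
  fix c f assume f: "f \<in> hermitian_jacobi_forms k m"
  have "cscale c f \<in> holomorphic_functions"
    using f cfun.subspace_scale[OF subspace_holomorphic_functions]
    by (auto simp: hermitian_jacobi_forms_def)
  then show "cscale c f \<in> hermitian_jacobi_forms k m"
    using f unfolding hermitian_jacobi_forms_def mem_Collect_eq
    apply (elim conjE exE)
    subgoal for C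
      by (intro conjI exI[of _ "\<lambda>n r. c * C n r"])
        (simp_all add: cscale_def mult.left_commute[of _ c] has_sum_fourier_scale)
    done
qed

lemma subspace_jacobi_forms: "cfun.subspace (jacobi_forms k M)"
proof (rule cfun.subspaceI)
  show "0 \<in> jacobi_forms k M"
    using cfun.subspace_0[OF subspace_holomorphic_functions]
    by (auto simp: jacobi_forms_def case_prod_unfold intro!: exI[of _ "\<lambda>_ _. 0"])
next
  fix f g assume f: "f \<in> jacobi_forms k M" and g: "g \<in> jacobi_forms k M"
  have "f + g \<in> holomorphic_functions"
    using f g cfun.subspace_add[OF subspace_holomorphic_functions]
    by (auto simp: jacobi_forms_def)
  then show "f + g \<in> jacobi_forms k M"
    using f g unfolding jacobi_forms_def mem_Collect_eq
    apply (elim conjE exE)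
    subgoal for C D
      by (intro conjI exI[of _ "\<lambda>n r. C n r + D n r"])
        (simp_all add: distrib_left has_sum_fourier_add)
    done
next
  fix c f assume f: "f \<in> jacobi_forms k M"
  have "cscale c f \<in> holomorphic_functions"
    using f cfun.subspace_scale[OF subspace_holomorphic_functions]
    by (auto simp: jacobi_forms_def)
  then show "cscale c f \<in> jacobi_forms k M"
    using f unfolding jacobi_forms_def mem_Collect_eq
    apply (elim conjE exE)
    subgoal for C
      by (intro conjI exI[of _ "\<lambda>n r. c * C n r"])
        (simp_all add: cscale_def mult.left_commute[of _ c] has_sum_fourier_scale)
    done
qed

end

theory Submission
  imports Defs
begin

text \<open>
  The isomorphism is the linear change of variables \<open>z\<^sub>1 = w\<^sub>1 + i w\<^sub>2\<close>, \<open>z\<^sub>2 = w\<^sub>1 - i w\<^sub>2\<close>.  It turns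
  \<open>m z\<^sub>1 z\<^sub>2\<close> into \<open>B[w]\<close>, a Gaussian translation \<open>(\<lambda>, cnj \<lambda>)\<close> into translation by the integral
  vector \<open>(Re \<lambda>, Im \<lambda>)\<close>, and \<open>r z\<^sub>1 + cnj r z\<^sub>2\<close> into \<open>s\<^sup>t w\<close> with \<open>s = (2 Re r, -2 Im r)\<close>, which
  identifies the inverse different with \<open>\<int>\<^sup>2\<close>.  Each defining condition of one space thereby becomes
  the corresponding condition of the other.
\<close>

definition null_coords :: "complex ^ 2 \<Rightarrow> complex ^ 2" where
  "null_coords w = vector [w $ 1 + \<i> * w $ 2, w $ 1 - \<i> * w $ 2]"

definition null_coords_inv :: "complex ^ 2 \<Rightarrow> complex ^ 2" where
  "null_coords_inv z = vector [(z $ 1 + z $ 2) / 2, (z $ 1 - z $ 2) / (2 * \<i>)]"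

lemma null_coords_inverse [simp]:
  "null_coords (null_coords_inv z) = z" "null_coords_inv (null_coords w) = w"
  by (auto simp: null_coords_def null_coords_inv_def vec_eq_iff forall_2 field_simps)

lemma linear_null_coords: "Vector_Spaces.linear (*s) (*s) null_coords"
  by unfold_locales (auto simp: null_coords_def vec_eq_iff forall_2 algebra_simps)

lemma linear_null_coords_inv: "Vector_Spaces.linear (*s) (*s) null_coords_inv"
  by unfold_locales (auto simp: null_coords_inv_def vec_eq_iff forall_2 field_simps)

definition pullback :: "('b \<Rightarrow> 'b) \<Rightarrow> ('a \<times> 'b \<Rightarrow> 'c) \<Rightarrow> 'a \<times> 'b \<Rightarrow> 'c" where
  "pullback L \<phi> = (\<lambda>p. \<phi> (fst p, L (snd p)))"

text \<open>Bridge from complex linearity of a coordinate change to the real linearity on which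
  boundedness and Frechet derivatives rest.\<close>

lemma scaleR_eq_vector_scalar_mult:
  "r *\<^sub>R v = of_real r *s (v :: complex ^ 'n)"
  by (simp add: vec_eq_iff scaleR_conv_of_real[where 'a = complex])

text \<open>Chain rule: a linear \<open>L\<close> on a finite-dimensional space is its own
  derivative, and composing the complex linear \<open>D\<close> with the complex linear
  \<open>L\<close> stays complex linear.\<close>

lemma pullback_holomorphic:
  fixes L :: "complex ^ 'l \<Rightarrow> complex ^ 'l"
  assumes L: "Vector_Spaces.linear (*s) (*s) L" and \<phi>: "\<phi> \<in> holomorphic_functions"
  shows "pullback L \<phi> \<in> holomorphic_functions"
proof -
  interpret L: Vector_Spaces.linear "(*s)" "(*s)" L by (rule L)
  have "linear L"
    by (rule linearI) (simp_all add: L.add L.scale scaleR_eq_vector_scalar_mult)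
  then have bl: "bounded_linear L"
    by (simp add: linear_conv_bounded_linear)
  have "\<exists>D. (pullback L \<phi> has_derivative D) (at p) \<and> (\<forall>c h v. D (c * h, c *s v) = c * D (h, v))"
    if p: "p \<in> upper_half_plane \<times> UNIV" for p
  proof -
    define q where "q = (fst p, L (snd p))"
    have "q \<in> upper_half_plane \<times> UNIV"
      using p by (auto simp: q_def)
    then obtain D where D: "(\<phi> has_derivative D) (at q)" "\<forall>c h v. D (c * h, c *s v) = c * D (h, v)"
      using \<phi> unfolding holomorphic_functions_def by blast
    have "((\<lambda>x. (fst x, L (snd x))) has_derivative (\<lambda>x. (fst x, L (snd x)))) (at p)"
      by (intro has_derivative_Pair bounded_linear.has_derivative[OF bl]
          has_derivative_fst has_derivative_snd has_derivative_ident)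
    from diff_chain_at[OF this] D(1)
    have "(pullback L \<phi> has_derivative (\<lambda>x. D (fst x, L (snd x)))) (at p)"
      by (simp add: q_def pullback_def o_def)
    with D(2) show ?thesis
      by (intro exI[of _ "\<lambda>x. D (fst x, L (snd x))"]) (simp add: L.scale)
  qed
  \<comment> \<open>The first coordinate is untouched, so the extension by 0 outside the domain is
    preserved as well.\<close>
  with \<phi> show ?thesis
    by (auto simp: holomorphic_functions_def pullback_def)
qed

lemma pullback_null_coords_inverse [simp]:
  "pullback null_coords (pullback null_coords_inv \<phi>) = \<phi>"
  "pullback null_coords_inv (pullback null_coords \<phi>) = \<phi>"
  by (simp_all add: pullback_def)

lemma pullback_null_coords_holomorphic_iff:
  "pullback null_coords \<phi> \<in> holomorphic_functions \<longleftrightarrow> \<phi> \<in> holomorphic_functions"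
  using pullback_holomorphic[OF linear_null_coords]
    pullback_holomorphic[OF linear_null_coords_inv, of "pullback null_coords \<phi>"]
  by auto

text \<open>Surjectivity of \<open>null_coords\<close>, put as a rewrite rule for the quantifiers
  over \<open>z1\<close> and \<open>z2\<close> in the Hermitian conditions.\<close>

lemma all_null_coords:
  "(\<forall>z1 z2. P z1 z2) \<longleftrightarrow> (\<forall>w :: complex ^ 2. P (w $ 1 + \<i> * w $ 2) (w $ 1 - \<i> * w $ 2))"
proof (intro iffI allI)
  fix z1 z2 :: complex
  assume *: "\<forall>w :: complex ^ 2. P (w $ 1 + \<i> * w $ 2) (w $ 1 - \<i> * w $ 2)"
  show "P z1 z2"
    using *[rule_format, of "null_coords_inv (vector [z1, z2])"]
    by (simp add: null_coords_inv_def flip: add_divide_distrib diff_divide_distrib)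
qed simp

lemma ball_gaussian_integers:
  "(\<forall>x\<in>gaussian_integers. P x) \<longleftrightarrow>
     (\<forall>v :: int ^ 2. P (of_int (v $ 1) + of_int (v $ 2) * \<i>))"
proof (intro iffI ballI allI)
  fix x assume *: "\<forall>v :: int ^ 2. P (of_int (v $ 1) + of_int (v $ 2) * \<i>)"
    and "x \<in> gaussian_integers"
  then obtain a b where "x = of_int a + of_int b * \<i>"
    by (auto simp: gaussian_integers_def)
  then show "P x"
    using *[rule_format, of "vector [a, b]"] by simp
qed (auto simp: gaussian_integers_def)

text \<open>Inverse of the map sending r to (2 Re r, -2 Im r).\<close>

definition dual_point :: "int ^ 2 \<Rightarrow> complex" where
  "dual_point s = (of_int (s $ 1) - \<i> * of_int (s $ 2)) / 2"

lemma inj_dual_point: "inj dual_point"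
  by (auto simp: inj_def dual_point_def complex_eq_iff vec_eq_iff forall_2)

lemma range_dual_point: "range dual_point = inverse_different"
proof (intro equalityI subsetI)
  fix r assume "r \<in> inverse_different"
  then obtain a b where "r = \<i> / 2 * (of_int a + of_int b * \<i>)"
    by (auto simp: inverse_different_def gaussian_integers_def)
  \<comment> \<open>Multiplying out gives (-b + a i)/2, to be read as (s1 - i s2)/2.\<close>
  then have "r = dual_point (vector [- b, - a])"
    by (simp add: dual_point_def complex_eq_iff)
  then show "r \<in> range dual_point" by blast
next
  fix r assume "r \<in> range dual_point"
  then obtain s where "r = dual_point s" by blast
  then have "r = \<i> / 2 * (of_int (- s $ 2) + of_int (- s $ 1) * \<i>)"
    by (simp add: dual_point_def complex_eq_iff)
  then show "r \<in> inverse_different"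
    unfolding inverse_different_def gaussian_integers_def by blast
qed

lemma gnorm_dual_point:
  "gnorm (dual_point s) = ((of_int (s $ 1))\<^sup>2 + (of_int (s $ 2))\<^sup>2) / 4"
  by (simp add: gnorm_def dual_point_def power2_eq_square field_simps)

lemma dual_point_pairing:
  "dual_point s * (w $ 1 + \<i> * w $ 2) + cnj (dual_point s) * (w $ 1 - \<i> * w $ 2)
     = scalar_product (of_int_vec s) w"
  by (simp add: dual_point_def scalar_product_def of_int_vec_def sum_2 complex_eq_iff field_simps)

text \<open>By injectivity, coefficients on \<int>^2 transport along \<open>inv dual_point\<close>;
  values off the range of \<open>dual_point\<close> never reach \<open>Q\<close>.\<close>

lemma ex_dual_coefficients:
  "(\<exists>C :: int \<Rightarrow> complex \<Rightarrow> complex. Q (\<lambda>n s. C n (dual_point s))) \<longleftrightarrow> (\<exists>C. Q C)"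
proof
  assume "\<exists>C. Q C"
  then obtain C where "Q C" by blast
  then have "Q (\<lambda>n s. C n (inv dual_point (dual_point s)))"
    by (simp add: inj_dual_point)
  then show "\<exists>C :: int \<Rightarrow> complex \<Rightarrow> complex. Q (\<lambda>n s. C n (dual_point s))"
    by (intro exI[of _ "\<lambda>n r. C n (inv dual_point r)"])
qed blast

text \<open>The entries of \<open>of_int_vec u\<close> are real, so its null coordinates are a
  Gaussian integer and its conjugate.\<close>

lemma null_coords_translate:
  "null_coords (w + \<tau> *s of_int_vec u + of_int_vec v) =
     vector [w $ 1 + \<i> * w $ 2 + (of_int (u $ 1) + of_int (u $ 2) * \<i>) * \<tau>
               + (of_int (v $ 1) + of_int (v $ 2) * \<i>),
             w $ 1 - \<i> * w $ 2 + cnj (of_int (u $ 1) + of_int (u $ 2) * \<i>) * \<tau>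
               + cnj (of_int (v $ 1) + of_int (v $ 2) * \<i>)]"
  by (simp add: null_coords_def of_int_vec_def algebra_simps)

lemma null_coords_scale:
  "null_coords ((1 / j) *s w) = vector [(w $ 1 + \<i> * w $ 2) / j, (w $ 1 - \<i> * w $ 2) / j]"
  by (simp add: null_coords_def add_divide_distrib diff_divide_distrib)

context
  fixes m k :: int and B :: "real ^ 2 ^ 2"
  assumes m: "m \<ge> 1"
    and B: "B = vector [vector [of_int m, 0], vector [0, of_int m]]"
begin

lemma quad_form_null_coords:
  "quad_form (map_matrix of_real B) w =
     of_int m * (w $ 1 + \<i> * w $ 2) * (w $ 1 - \<i> * w $ 2)"
  by (simp add: B quad_form_def scalar_product_def matrix_vector_mult_def sum_2
      map_matrix_def algebra_simps)

lemma scalar_product_B: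
  "scalar_product v (map_matrix of_real B *v z) =
     of_int m * (v $ 1 * z $ 1 + v $ 2 * z $ 2 :: complex)"
  by (simp add: B scalar_product_def matrix_vector_mult_def sum_2 map_matrix_def algebra_simps)

text \<open>After division by the positive factor m, both sides bound the sum of squares
  \<open>q\<close> by 4mn.\<close>

lemma fourier_index_iff:
  "0 \<le> n \<and> 4 * det B * of_int n - quad_form (adjugate B) (of_int_vec s) \<ge> 0 \<longleftrightarrow>
     gnorm (dual_point s) \<le> of_int m * of_int n"
proof -
  define q :: real where "q = (of_int (s $ 1))\<^sup>2 + (of_int (s $ 2))\<^sup>2"
  \<comment> \<open>A scalar 2 x 2 matrix is its own adjugate.\<close>
  have "quad_form (adjugate B) (of_int_vec s) = of_int m * q"
    by (simp add: B quad_form_def adjugate_def of_int_vec_def scalar_product_def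
        matrix_vector_mult_def sum_2 det_2 axis_def q_def power2_eq_square algebra_simps)
  moreover have "det B = of_int m * of_int m"
    by (simp add: B det_2)
  ultimately have "4 * det B * of_int n - quad_form (adjugate B) (of_int_vec s)
      = of_int m * (4 * (of_int m * of_int n) - q)"
    by (simp add: algebra_simps)
  moreover have "0 \<le> of_int m * x \<longleftrightarrow> 0 \<le> x" for x :: real
    using m by (simp add: zero_le_mult_iff)
  \<comment> \<open>The Hermitian side states no sign condition on n; it comes from \<open>q\<close>
    \<ge> 0 and m > 0.\<close>
  moreover have "0 \<le> n" if "q \<le> 4 * (of_int m * of_int n)"
  proof -
    have "0 \<le> q" by (simp add: q_def)
    with that have "0 \<le> of_int m * (of_int n :: real)" by linarith
    then show ?thesis using m by (simp add: zero_le_mult_iff)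
  qed
  ultimately show ?thesis
    by (auto simp: gnorm_dual_point simp flip: q_def)
qed

lemma bij_betw_fourier_index:
  "bij_betw (\<lambda>(n, s). (n, dual_point s))
     {(n, s). 0 \<le> n \<and> 4 * det B * of_int n - quad_form (adjugate B) (of_int_vec s) \<ge> 0}
     {(n, r). r \<in> inverse_different \<and> gnorm r \<le> of_int m * of_int n}"
  unfolding bij_betw_def fourier_index_iff range_dual_point[symmetric]
  by (auto simp: inj_on_def inj_eq[OF inj_dual_point] image_iff)

text \<open>Unconditional sums are invariant under reindexing by a bijection, and
  \<open>dual_point_pairing\<close> matches the exponents.\<close>

lemma fourier_expansion_iff:
  "((\<lambda>(n, r). C n r * e2pi (of_int n * \<tau> + r * (w $ 1 + \<i> * w $ 2) + cnj r * (w $ 1 - \<i> * w $ 2)))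
      has_sum x) {(n, r). r \<in> inverse_different \<and> gnorm r \<le> of_int m * of_int n} \<longleftrightarrow>
   ((\<lambda>(n, s). C n (dual_point s) * e2pi (of_int n * \<tau> + scalar_product (of_int_vec s) w))
      has_sum x)
      {(n, s). 0 \<le> n \<and> 4 * det B * of_int n - quad_form (adjugate B) (of_int_vec s) \<ge> 0}"
  by (subst has_sum_reindex_bij_betw[OF bij_betw_fourier_index, symmetric])
    (simp add: case_prod_unfold add.assoc dual_point_pairing)

text \<open>For \<lambda> = u1 + u2 i the norm is u1^2 + u2^2, and in the two mixed terms the cross
  products cancel, leaving 2(u1 w1 + u2 w2).\<close>

lemma translation_exponent:
  "of_int m * ((of_int (u $ 1) + of_int (u $ 2) * \<i>) * cnj (of_int (u $ 1) + of_int (u $ 2) * \<i>) * \<tau>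
      + cnj (of_int (u $ 1) + of_int (u $ 2) * \<i>) * (w $ 1 + \<i> * w $ 2)
      + (of_int (u $ 1) + of_int (u $ 2) * \<i>) * (w $ 1 - \<i> * w $ 2))
   = \<tau> * quad_form (map_matrix of_real B) (of_int_vec u)
      + 2 * scalar_product (of_int_vec u) (map_matrix of_real B *v w)"
  unfolding quad_form_def scalar_product_B
  by (simp add: of_int_vec_def algebra_simps)

lemma pullback_null_coords_jacobi_iff:
  "pullback null_coords \<phi> \<in> jacobi_forms k B \<longleftrightarrow> \<phi> \<in> hermitian_jacobi_forms k m"
proof -
  have quad: "of_int m * of_int c * (w $ 1 + \<i> * w $ 2) * (w $ 1 - \<i> * w $ 2) =
      of_int c * quad_form (map_matrix of_real B) w" for c and w
    by (simp add: quad_form_null_coords)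
  show ?thesis
    unfolding hermitian_jacobi_forms_def jacobi_forms_def mem_Collect_eq
      pullback_null_coords_holomorphic_iff all_null_coords ball_gaussian_integers
      translation_exponent null_coords_translate[symmetric] quad null_coords_scale[symmetric]
      fourier_expansion_iff
    \<comment> \<open>Both sides now differ only in how the coefficients are indexed.
      \<open>Q\<close> is given explicitly, since matching alone does not determine it.\<close>
    unfolding pullback_def fst_conv snd_conv null_coords_def[symmetric]
      ex_dual_coefficients[of "\<lambda>C. \<forall>\<tau>\<in>upper_half_plane. \<forall>w. ((\<lambda>(n, s). C n s *
        e2pi (of_int n * \<tau> + scalar_product (of_int_vec s) w)) has_sum \<phi> (\<tau>, null_coords w))
        {(n, s). 0 \<le> n \<and> 4 * det B * of_int n - quad_form (adjugate B) (of_int_vec s) \<ge> 0}"]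
    by blast
qed

end

theorem theorem2p3:
  fixes m k :: int and B :: "real ^ 2 ^ 2"
  assumes "m \<ge> 1"
    and "B = vector [vector [of_int m, 0], vector [0, of_int m]]"
  shows "isomorphic_function_spaces (hermitian_jacobi_forms k m) (jacobi_forms k B)"
  unfolding isomorphic_function_spaces_def
proof (intro exI conjI)
  note iff = pullback_null_coords_jacobi_iff[OF assms]
  show "bij_betw (pullback null_coords) (hermitian_jacobi_forms k m) (jacobi_forms k B)"
  proof (rule bij_betw_byWitness[where f' = "pullback null_coords_inv"])
    \<comment> \<open>Read backwards, the equivalence reduces membership of the preimage to that of
      its pullback, which is the given Jacobi form.\<close>
    show "pullback null_coords_inv ` jacobi_forms k B \<subseteq> hermitian_jacobi_forms k m"
      by (auto simp flip: iff)
  qed (auto simp: iff)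
qed (auto simp: pullback_def cscale_def plus_fun_def)

end
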